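(* For every positive integer $a$ there are constants $C_{a,r}$, $r\in\{0,1,\dots,a-1\}$, such that for every positive integer $k$ with $k\equiv r\pmod a$, $$\alpha(k,2k+1)\le\frac{(3a+1)k+C_{a,r}}{a}.$$
   Context: For integers $1\le k\le n$, $\alpha(k,n)$ denotes the least number of entries equal to $1$ in an $n\times n$ matrix with entries in $\{0,1\}$ in which every $k\times k$ minor (the submatrix formed by any $k$ rows and any $k$ columns) contains at least one entry equal to $1$. *)

theory Defs
  imports
    Complex_Main
    "HOL-Number_Theory.Cong"
    "Jordan_Normal_Form.DL_Submatrix"
begin

definition hits_minors :: "nat \<Rightarrow> nat \<Rightarrow> nat mat \<Rightarrow> bool" where
  "hits_minors k n A \<longleftrightarrow>
     (\<forall>I J. I \<subseteq> {0..<n} \<and> J \<subseteq> {0..<n} \<and> card I = k \<and> card J = k \<longrightarrow>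
        1 \<in> elements_mat (submatrix A I J))"

definition num_ones :: "nat mat \<Rightarrow> nat" where
  "num_ones A = card {(i, j). i < dim_row A \<and> j < dim_col A \<and> A $$ (i, j) = 1}"

text \<open>The minimum ranges over a nonempty set exactly when \<open>1 \<le> k\<close> (for \<open>k = 0\<close> the only minor is
  empty), and the value is meant only for \<open>1 \<le> k \<le> n\<close>.\<close>

definition alpha :: "nat \<Rightarrow> nat \<Rightarrow> nat" where
  "alpha k n = (LEAST m. \<exists>A \<in> carrier_mat n n.
     elements_mat A \<subseteq> {0, 1} \<and> hits_minors k n A \<and> num_ones A = m)"

lemma one_in_submatrix_iff:
  assumes A: "A \<in> carrier_mat n n" and I: "I \<subseteq> {0..<n}" and J: "J \<subseteq> {0..<n}"
  shows "(1 :: nat) \<in> elements_mat (submatrix A I J) \<longleftrightarrow> (\<exists>i\<in>I. \<exists>j\<in>J. A $$ (i, j) = 1)"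
proof -
  have eqI: "{i. i < dim_row A \<and> i \<in> I} = I" and eqJ: "{j. j < dim_col A \<and> j \<in> J} = J"
    using A I J by auto
  have fin: "finite I" "finite J"
    using I J finite_subset by blast+
  show ?thesis
  proof
    assume "1 \<in> elements_mat (submatrix A I J)"
    then obtain i j where ij: "i < card I" "j < card J" "submatrix A I J $$ (i, j) = 1"
      by (auto elim!: elements_matD[elim_format] simp: dim_submatrix eqI eqJ)
    then have "A $$ (pick I i, pick J j) = 1"
      using submatrix_index[of i A I j J] by (simp add: eqI eqJ)
    then show "\<exists>i\<in>I. \<exists>j\<in>J. A $$ (i, j) = 1"
      using pick_in_set_le[OF ij(1)] pick_in_set_le[OF ij(2)] by blast
  next
    assume "\<exists>i\<in>I. \<exists>j\<in>J. A $$ (i, j) = 1"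
    then obtain i j where ij: "i \<in> I" "j \<in> J" "A $$ (i, j) = 1"
      by blast
    have lt: "i < dim_row A" "j < dim_col A"
      using A I J ij by auto
    have "card {a \<in> I. a < i} < card I" "card {a \<in> J. a < j} < card J"
      using ij fin by (auto intro!: psubset_card_mono)
    then show "1 \<in> elements_mat (submatrix A I J)"
      using submatrix_index_card[OF lt ij(1,2)] ij(3)
      by (metis dim_submatrix elements_matI eqI eqJ carrier_matI)
  qed
qed

lemma alpha_attained:
  assumes "1 \<le> k"
  shows "\<exists>A \<in> carrier_mat n n.
    elements_mat A \<subseteq> {0, 1} \<and> hits_minors k n A \<and> num_ones A = alpha k n"
proof -
  let ?A = "mat n n (\<lambda>_. 1 :: nat)"
  have "hits_minors k n ?A"
    unfolding hits_minors_def
  proof (intro allI impI)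
    fix I J :: "nat set"
    assume IJ: "I \<subseteq> {0..<n} \<and> J \<subseteq> {0..<n} \<and> card I = k \<and> card J = k"
    then obtain i j where ij: "i \<in> I" "j \<in> J"
      using assms by (metis card.empty ex_in_conv not_one_le_zero)
    then have "?A $$ (i, j) = 1"
      using IJ by (subst index_mat) auto
    with ij show "1 \<in> elements_mat (submatrix ?A I J)"
      using IJ by (subst one_in_submatrix_iff[of _ n]) auto
  qed
  moreover have "elements_mat ?A \<subseteq> {0, 1}"
    by (auto simp: elements_mat_def)
  ultimately have "\<exists>A \<in> carrier_mat n n.
      elements_mat A \<subseteq> {0, 1} \<and> hits_minors k n A \<and> num_ones A = num_ones ?A"
    by (intro bexI[of _ ?A]) auto
  then show ?thesis
    unfolding alpha_def by (rule LeastI)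
qed

end

theory Submission
  imports Defs
begin

text \<open>Let \<open>n = 2 k + 1\<close>. A matrix has the required property iff every set \<open>I\<close> of \<open>k\<close> rows meets ones in
  at least \<open>k + 2\<close> columns. Put ones on the diagonal, so that \<open>I\<close> itself accounts for \<open>k\<close> columns. On
  the first \<open>N = k + a + 2\<close> indices add a directed cycle \<open>i \<rightarrow> i + 1\<close> and, from every multiple of \<open>a\<close>, a
  chord \<open>i \<rightarrow> i + a + 1\<close> (indices modulo \<open>N\<close>). Only \<open>k - a - 1\<close> indices lie off the cycle, so \<open>I\<close> has
  between \<open>a + 1\<close> and \<open>k\<close> elements on it. Such a set has at least two successors outside itself: if the
  cycle edges give only one, the set is a cyclic interval, and the chord from the last multiple of \<open>a\<close>
  in it jumps past the end. There are \<open>3 k + k / a + O(1)\<close> ones.\<close>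

section \<open>Zero-one matrices as relations\<close>

text \<open>The pairs in \<open>E\<close> are the positions of the ones. A minor without a one would
  have \<open>k\<close> columns disjoint from the image of \<open>I\<close>, and these do not fit
  into \<open>n\<close> columns.\<close>

lemma alpha_le_card:
  assumes E: "E \<subseteq> {..<n} \<times> {..<n}"
    and exp: "\<And>I. I \<subseteq> {..<n} \<Longrightarrow> card I = k \<Longrightarrow> n < card (E `` I) + k"
  shows "alpha k n \<le> card E"
proof -
  define A where "A = mat n n (\<lambda>p. if p \<in> E then 1 else 0 :: nat)"
  have car: "A \<in> carrier_mat n n" by (simp add: A_def)
  have idx: "A $$ (i, j) = 1 \<longleftrightarrow> (i, j) \<in> E" if "i < n" "j < n" for i j
    using that by (simp add: A_def)
  have el: "elements_mat A \<subseteq> {0, 1}"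
    by (auto simp: elements_mat_def A_def)
  have "{(i, j). i < dim_row A \<and> j < dim_col A \<and> A $$ (i, j) = 1} = E"
    using E car idx by fastforce
  then have num: "num_ones A = card E" by (simp add: num_ones_def)
  have "hits_minors k n A"
    unfolding hits_minors_def
  proof (intro allI impI)
    fix I J :: "nat set"
    assume IJ: "I \<subseteq> {0..<n} \<and> J \<subseteq> {0..<n} \<and> card I = k \<and> card J = k"
    have "E `` I \<inter> J \<noteq> {}"
    proof
      assume disj: "E `` I \<inter> J = {}"
      have sub: "E `` I \<subseteq> {..<n}" "J \<subseteq> {..<n}" using E IJ by auto
      then have "card (E `` I) + card J = card (E `` I \<union> J)"
        using disj finite_subset[OF _ finite_lessThan] by (metis card_Un_disjoint)
      also have "\<dots> \<le> card {..<n}"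
        using sub by (intro card_mono) auto
      finally show False using exp[of I] IJ by (auto simp: lessThan_atLeast0)
    qed
    then obtain i j where "i \<in> I" "j \<in> J" "(i, j) \<in> E" by blast
    moreover have "i < n" "j < n" using E \<open>(i, j) \<in> E\<close> by auto
    ultimately show "1 \<in> elements_mat (submatrix A I J)"
      using IJ car idx by (subst one_in_submatrix_iff[of _ n]) blast+
  qed
  then show ?thesis
    unfolding alpha_def using car el num by (intro Least_le) blast
qed

section \<open>Walks around a cycle modulo \<open>N\<close>\<close>

lemma add_mod_eq_iff:
  fixes N y :: nat
  assumes "s \<le> t" "t < s + N"
  shows "(y + s) mod N = (y + t) mod N \<longleftrightarrow> s = t"
proof
  assume "(y + s) mod N = (y + t) mod N"
  then have "N dvd (y + t) - (y + s)"
    using assms mod_eq_dvd_iff_nat[of "y + s" "y + t" N] by simp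
  then show "s = t"
    using assms by (auto dest!: dvd_imp_le)
qed simp

text \<open>The range \<open>{1..N}\<close> lets the walk begin at the successor of \<open>y\<close>
  and, for \<open>y < N\<close>, come back to \<open>y\<close> only at \<open>t = N\<close>.\<close>

lemma bij_betw_add_mod:
  fixes N y :: nat
  assumes "0 < N"
  shows "bij_betw (\<lambda>t. (y + t) mod N) {1..N} {..<N}"
proof -
  have "inj_on (\<lambda>t. (y + t) mod N) {1..N}"
  proof (rule linorder_inj_onI)
    fix s t assume "s < t" "s \<in> {1..N}" "t \<in> {1..N}"
    then show "(y + s) mod N \<noteq> (y + t) mod N"
      by (subst add_mod_eq_iff) auto
  qed auto
  moreover have "(\<lambda>t. (y + t) mod N) ` {1..N} = {..<N}"
    using assms card_image[OF calculation] by (intro card_subset_eq) auto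
  ultimately show ?thesis by (simp add: bij_betw_def)
qed

text \<open>A set closed under successors contains the whole walk from any of its elements, and this
  walk covers \<open>{..<N}\<close>.\<close>

lemma cycle_exit:
  fixes N :: nat
  assumes S: "S \<subseteq> {..<N}" "S \<noteq> {}" "S \<noteq> {..<N}"
  shows "\<exists>y\<in>S. (y + 1) mod N \<notin> S"
proof (rule ccontr)
  assume "\<not> ?thesis"
  then have closed: "(y + 1) mod N \<in> S" if "y \<in> S" for y using that by blast
  obtain x where x: "x \<in> S" using S by blast
  have "(x + t) mod N \<in> S" for t
  proof (induction t)
    case 0
    then show ?case using x S by auto
  next
    case (Suc t)
    then show ?case using closed[of "(x + t) mod N"] by (simp add: mod_Suc_eq)
  qed
  then have "(\<lambda>t. (x + t) mod N) ` {1..N} \<subseteq> S" by blast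
  moreover have "(\<lambda>t. (x + t) mod N) ` {1..N} = {..<N}"
    using bij_betw_add_mod[of N x] x S by (auto simp: bij_betw_def)
  ultimately show False using S by simp
qed

section \<open>The chorded cycle and its expansion\<close>

text \<open>With length \<open>a + 1\<close>, a chord starting at most \<open>a - 1\<close> steps
  before a vertex ends 2 to \<open>a + 1\<close> steps after it, beyond its successor.\<close>

definition chorded_cycle :: "nat \<Rightarrow> nat \<Rightarrow> (nat \<times> nat) set" where
  "chorded_cycle a N = (\<lambda>i. (i, (i + 1) mod N)) ` {..<N}
     \<union> (\<lambda>q. (q * a, (q * a + a + 1) mod N)) ` {q. q * a < N}"

lemma chorded_cycle_succ: "i < N \<Longrightarrow> (i, (i + 1) mod N) \<in> chorded_cycle a N"
  by (auto simp: chorded_cycle_def)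

lemma chorded_cycle_chord:
  assumes "i < N" "a dvd i"
  shows "(i, (i + a + 1) mod N) \<in> chorded_cycle a N"
  using assms by (auto simp: chorded_cycle_def mult.commute elim!: dvdE)

lemma chorded_cycle_subset: "chorded_cycle a N \<subseteq> {..<N} \<times> {..<N}"
proof (cases "N = 0")
  case False
  then show ?thesis by (auto simp: chorded_cycle_def)
qed (auto simp: chorded_cycle_def)

lemma card_chorded_cycle:
  assumes "0 < a"
  shows "card (chorded_cycle a N) \<le> N + (N div a + 1)"
proof -
  have sub: "{q. q * a < N} \<subseteq> {..N div a}"
    using assms by (auto simp: less_eq_div_iff_mult_less_eq)
  have "card (chorded_cycle a N) \<le> card {..<N} + card {q. q * a < N}"
    unfolding chorded_cycle_def
    by (intro order_trans[OF card_Un_le] add_mono card_image_le)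
       (auto intro: finite_subset[OF sub])
  also have "card {q. q * a < N} \<le> card {..N div a}"
    using sub by (intro card_mono) auto
  finally show ?thesis by simp
qed

text \<open>If \<open>S\<close> is a cyclic interval, the lower bound on its size puts a multiple of
  \<open>a\<close> among its last \<open>a\<close> elements, and the upper bound leaves a gap of at
  least \<open>a + 1\<close> vertices after it, where the chord from that multiple lands.\<close>

lemma chorded_cycle_two_exits:
  assumes a: "0 < a" and S: "S \<subseteq> {..<N}" "a \<le> card S" "card S + a + 1 \<le> N"
  shows "2 \<le> card (chorded_cycle a N `` S - S)"
proof -
  have "S \<noteq> {}" "S \<noteq> {..<N}" using a S by auto
  then obtain y where y: "y \<in> S" "(y + 1) mod N \<notin> S" using cycle_exit S by blast
  have yN: "y < N" using y S by auto
  have "\<exists>v. v \<noteq> (y + 1) mod N \<and> v \<in> chorded_cycle a N `` S - S"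
  proof (cases "\<exists>x\<in>S. x \<noteq> y \<and> (x + 1) mod N \<notin> S")
    case True
    then obtain x where x: "x \<in> S" "x \<noteq> y" "(x + 1) mod N \<notin> S" by blast
    have "x < N" using x S by auto
    then have "(1 + x) mod N \<noteq> (1 + y) mod N"
      using yN x add_mod_eq_iff[of x y N 1] add_mod_eq_iff[of y x N 1]
      by (metis le_cases trans_less_add2)
    then show ?thesis using x chorded_cycle_succ[OF \<open>x < N\<close>, of a] by auto
  next
    case False
    \<comment> \<open>Now \<open>y\<close> is the only exit along cycle edges. Numbering the cycle
      from the successor of \<open>y\<close>, with \<open>f N = y\<close>, turns \<open>S\<close>
      into a final segment \<open>T\<close> of \<open>{1..N}\<close>.\<close>
    define f where "f t = (y + t) mod N" for t
    define T where "T = {t \<in> {1..N}. f t \<in> S}"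
    have bij: "bij_betw f {1..N} {..<N}"
      unfolding f_def using bij_betw_add_mod yN by simp
    have "f ` {1..N} = {..<N}" using bij by (simp add: bij_betw_def)
    then have "S \<subseteq> f ` {1..N}" using S(1) by simp
    then have "S = f ` T" unfolding T_def by blast
    moreover have "inj_on f T"
      using bij by (auto simp: T_def bij_betw_def intro: inj_on_subset)
    ultimately have cardT: "card T = card S" by (simp add: card_image)
    \<comment> \<open>Only the cycle edge from \<open>y\<close> leaves \<open>S\<close>, and
      \<open>f t = y\<close> happens only at \<open>t = N\<close>.\<close>
    have step: "Suc t \<in> T" if "t \<in> T" "t < N" for t
    proof -
      have "f t \<noteq> y"
        using add_mod_eq_iff[of 0 t N y] that yN by (auto simp: f_def T_def)
      then have "(f t + 1) mod N \<in> S" using that False by (auto simp: T_def)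
      then show ?thesis using that by (auto simp: T_def f_def mod_Suc_eq)
    qed
    have up: "s \<in> T" if "t \<in> T" "t \<le> s" "s \<le> N" for s t
      using that(2,3,1) by (induction s rule: dec_induct) (auto intro: step)
    \<comment> \<open>The size of a final segment determines it: at least \<open>a\<close> members
      fill the last \<open>a\<close> positions, and at least \<open>a + 1\<close> non-members fill
      the first \<open>a + 1\<close>.\<close>
    have last: "t \<in> T" if "N - a < t" "t \<le> N" for t
    proof (rule ccontr)
      assume "t \<notin> T"
      then have "t < x" if "x \<in> T" for x
        using up[OF that] \<open>t \<le> N\<close> by (meson not_le)
      then have "T \<subseteq> {t<..N}" by (simp add: T_def subset_iff)
      then have "card T \<le> card {t<..N}" by (intro card_mono) auto
      then show False using that S cardT by simp
    qed
    have first: "t \<notin> T" if "t \<le> a + 1" for t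
    proof
      assume "t \<in> T"
      then have "{t..N} \<subseteq> T" using up by auto
      then have "card {t..N} \<le> card T" by (intro card_mono) (auto simp: T_def)
      then show False using that S cardT by simp
    qed
    \<comment> \<open>\<open>y - j\<close> is the greatest multiple of \<open>a\<close> up to
      \<open>y\<close>. It has position \<open>N - j\<close>, one of the last
      \<open>a\<close>.\<close>
    define j where "j = y mod a"
    have j: "j < a" "j \<le> y" using a by (auto simp: j_def)
    have "f (N - j) = (N + (y - j)) mod N"
      using j S by (simp add: f_def algebra_simps)
    also have "\<dots> = y - j" using yN by simp
    finally have "y - j \<in> S"
      using last[of "N - j"] j S by (auto simp: T_def)
    moreover have "(y - j, (y - j + a + 1) mod N) \<in> chorded_cycle a N"
    proof (rule chorded_cycle_chord)
      show "y - j < N" using yN by simp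
      show "a dvd y - j" by (simp add: j_def dvd_minus_mod)
    qed
    \<comment> \<open>The chord ends at position \<open>a + 1 - j\<close>, between 2 and
      \<open>a + 1\<close>: outside \<open>S\<close> by \<open>first\<close>, and different from
      position 1, the exit already found.\<close>
    moreover have "y - j + a + 1 = y + (a + 1 - j)" using j by simp
    then have "(y - j + a + 1) mod N = f (a + 1 - j)" by (simp only: f_def)
    moreover have "f (a + 1 - j) \<notin> S"
      using first[of "a + 1 - j"] j S by (auto simp: T_def)
    moreover have "f 1 = f (a + 1 - j) \<longleftrightarrow> 1 = a + 1 - j"
      unfolding f_def using j S by (intro add_mod_eq_iff) linarith+
    then have "f (a + 1 - j) \<noteq> (y + 1) mod N"
      using j by (auto simp: f_def)
    ultimately show ?thesis by (metis DiffI ImageI)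
  qed
  then obtain v where "v \<noteq> (y + 1) mod N" "v \<in> chorded_cycle a N `` S - S" by blast
  then have "{(y + 1) mod N, v} \<subseteq> chorded_cycle a N `` S - S"
    using y chorded_cycle_succ[OF yN, of a] by auto
  moreover have "finite (chorded_cycle a N `` S - S)"
    using chorded_cycle_subset[of a N] by (blast intro: finite_subset[of _ "{..<N}"])
  ultimately have "card {(y + 1) mod N, v} \<le> card (chorded_cycle a N `` S - S)"
    by (rule card_mono[rotated])
  then show ?thesis using \<open>v \<noteq> _\<close> by simp
qed

section \<open>Bounds on \<open>alpha\<close>\<close>

text \<open>The bound adds \<open>n\<close> diagonal ones, \<open>N\<close> cycle edges and at most
  \<open>N div a + 1\<close> chords. The condition \<open>a < k\<close> makes the cycle fit:
  \<open>N \<le> n\<close>.\<close>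

lemma alpha_chorded_cycle_bound:
  assumes a: "0 < a" "a < k"
  shows "alpha k (2 * k + 1) \<le> 3 * k + (k + a + 2) div a + a + 4"
proof -
  define n N E where "n = 2 * k + 1" and "N = k + a + 2" and "E = Id_on {..<n} \<union> chorded_cycle a N"
  have Nn: "N \<le> n" using a by (simp add: n_def N_def)
  have Esub: "E \<subseteq> {..<n} \<times> {..<n}"
    using chorded_cycle_subset[of a N] Nn by (auto simp: E_def)
  have "alpha k n \<le> card E"
  proof (rule alpha_le_card[OF Esub])
    fix I assume I: "I \<subseteq> {..<n}" "card I = k"
    have fin: "finite I" using I finite_subset by blast
    define S where "S = I \<inter> {..<N}"
    have "card (I - S) \<le> card {N..<n}"
      using I by (intro card_mono) (auto simp: S_def)
    moreover have "card (I - S) + card S = k"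
      using fin I card_Diff_subset[of S I] card_mono[of I S] by (auto simp: S_def)
    \<comment> \<open>The choice of \<open>N\<close> makes \<open>card S\<close> at least
      \<open>k - (n - N) = a + 1\<close> and at most \<open>k = N - a - 2\<close>.\<close>
    ultimately have "a \<le> card S" "card S + a + 1 \<le> N"
      using a by (auto simp: n_def N_def)
    then have 2: "2 \<le> card (chorded_cycle a N `` S - S)"
      using a by (intro chorded_cycle_two_exits) (auto simp: S_def)
    have sub: "I \<union> (chorded_cycle a N `` S - S) \<subseteq> E `` I"
      using I by (auto simp: E_def S_def)
    have "E `` I \<subseteq> {..<n}" using Esub by blast
    then have "card (I \<union> (chorded_cycle a N `` S - S)) \<le> card (E `` I)"
      using sub by (intro card_mono) (auto intro: finite_subset)
    moreover have "card (I \<union> (chorded_cycle a N `` S - S)) = k + card (chorded_cycle a N `` S - S)"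
    proof -
      \<comment> \<open>The new successors lie in \<open>{..<N}\<close>, where \<open>I\<close>
        coincides with \<open>S\<close>, so they avoid all of \<open>I\<close>.\<close>
      have "I \<inter> (chorded_cycle a N `` S - S) = {}"
        using chorded_cycle_subset[of a N] by (auto simp: S_def)
      moreover have "finite (chorded_cycle a N `` S - S)"
        using 2 by (intro card_ge_0_finite) simp
      ultimately show ?thesis using fin I by (simp add: card_Un_disjoint)
    qed
    ultimately show "n < card (E `` I) + k" using 2 by (simp add: n_def)
  qed
  also have "card E \<le> card (Id_on {..<n}) + card (chorded_cycle a N)"
    unfolding E_def by (rule card_Un_le)
  also have "card (Id_on {..<n}) = n"
  proof -
    have "Id_on {..<n} = (\<lambda>i. (i, i)) ` {..<n}" by auto
    then show ?thesis by (simp add: card_image inj_on_def)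
  qed
  finally show ?thesis
    using card_chorded_cycle[OF a(1), of N] by (simp add: n_def N_def)
qed

text \<open>This is the all-ones matrix, a crude bound for the finitely many
  \<open>k \<le> a\<close>.\<close>

lemma alpha_le_square:
  assumes "0 < k"
  shows "alpha k n \<le> n * n"
proof -
  have "alpha k n \<le> card ({..<n} \<times> {..<n})"
  proof (rule alpha_le_card)
    fix I assume I: "I \<subseteq> {..<n}" "card I = k"
    then have "I \<noteq> {}" using assms by auto
    then have "({..<n} \<times> {..<n}) `` I = {..<n}" using I by auto
    then show "n < card (({..<n} \<times> {..<n}) `` I) + k" using assms by simp
  qed simp
  then show ?thesis by simp
qed

theorem theorem5:
  fixes a :: nat
  assumes "a \<ge> 1"
  shows "\<exists>C :: nat \<Rightarrow> real. \<forall>r \<in> {0..<a}. \<forall>k :: nat. k \<ge> 1 \<and> [k = r] (mod a) \<longrightarrow>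
           real (alpha k (2 * k + 1)) \<le> ((3 * real a + 1) * real k + C r) / real a"
proof -
  \<comment> \<open>The square covers \<open>k \<le> a\<close>, where the matrix has at most
    \<open>2 * a + 1\<close> rows. For \<open>k > a\<close>, the term \<open>a + 7\<close> collects
    \<open>a + 4\<close> from the count of ones and \<open>1 + 2 / a \<le> 3\<close> from the
    chords. The factor \<open>a\<close> cancels the division.\<close>
  define C where "C = real a * ((2 * real a + 1) * (2 * real a + 1) + real a + 7)"
  have "real (alpha k (2 * k + 1)) \<le> ((3 * real a + 1) * real k + C) / real a" if k: "k \<ge> 1" for k
  proof -
    have rhs: "((3 * real a + 1) * real k + C) / real a
        = 3 * real k + real k / real a + ((2 * real a + 1) * (2 * real a + 1) + real a + 7)"
      using assms by (simp add: C_def add_divide_distrib distrib_right)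
    show ?thesis
    proof (cases "a < k")
      case True
      have "real (alpha k (2 * k + 1)) \<le> real (3 * k + (k + a + 2) div a + a + 4)"
        using alpha_chorded_cycle_bound[OF _ True] assms by (subst of_nat_le_iff) simp
      also have "\<dots> \<le> 3 * real k + real (k + a + 2) / real a + real a + 4"
        using of_nat_div_le_of_nat[of "k + a + 2" a, where 'a = real] by simp
      also have "real (k + a + 2) / real a = real k / real a + 1 + 2 / real a"
        using assms by (simp add: field_simps)
      also have "2 / real a \<le> 2" using assms by (simp add: field_simps)
      finally have "real (alpha k (2 * k + 1)) \<le> 3 * real k + real k / real a + real a + 7" by simp
      then show ?thesis unfolding rhs by (smt (verit) zero_le_square)
    next
      case False
      have "alpha k (2 * k + 1) \<le> (2 * k + 1) * (2 * k + 1)"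
        using k by (intro alpha_le_square) simp
      also have "\<dots> \<le> (2 * a + 1) * (2 * a + 1)"
        using False by (intro mult_mono) auto
      finally have "real (alpha k (2 * k + 1)) \<le> real ((2 * a + 1) * (2 * a + 1))"
        by (subst of_nat_le_iff)
      then have "real (alpha k (2 * k + 1)) \<le> (2 * real a + 1) * (2 * real a + 1)"
        by (simp only: of_nat_mult of_nat_add of_nat_numeral of_nat_1)
      moreover have "0 \<le> real k / real a" by simp
      ultimately show ?thesis unfolding rhs by linarith
    qed
  qed
  then show ?thesis by (intro exI[of _ "\<lambda>_. C"]) auto
qed

end
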